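(* Let $\Gamma$ be the zero-sum stochastic game with state space $K=\{\omega_1,\omega_2,1^*,0^*\}$, action sets $I=\{T,M,B\}$ for Player 1 and $J=\{L,R\}$ for Player 2, and deterministic transitions and payoffs given as follows. In state $\omega_1$: $(T,L)$ gives payoff $1$ and the state stays $\omega_1$; $(T,R)$ gives payoff $1$ and the state moves to $\omega_2$; $(M,L)$ and $(M,R)$ give payoff $0$ and the state stays $\omega_1$; $(B,L)$ gives payoff $1$ and the state moves to $\omega_2$; $(B,R)$ gives payoff $1$ and the state moves to $1^*$. In state $\omega_2$: $(T,L)$ gives payoff $0$ and the state stays $\omega_2$; $(T,R)$ gives payoff $0$ and the state moves to $\omega_1$; $(M,L)$ and $(M,R)$ give payoff $0$ and the state stays $\omega_2$; $(B,L)$ gives payoff $0$ and the state moves to $\omega_1$; $(B,R)$ gives payoff $0$ and the state moves to $0^*$. The states $1^*$ and $0^*$ are absorbing, with payoff $1$ and $0$ respectively whatever the actions. Then for all $p>1/2$ (with $p\in(0,+\infty]$), $\Gamma$ has no $p$-asymptotic value.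
   Context: Notation: $\mathbb{N}^*=\{1,2,\dots\}$; $\Delta(C)$ is the set of probability measures on $C$; $\Delta(\mathbb{N}^* )$ is the set of sequences $\pi=(\pi_m)_{m\ge1}$ of nonnegative reals with $\sum_{m\ge1}\pi_m=1$. Stochastic game: A finite zero-sum stochastic game consists of nonempty finite sets $K$ (states), $I$ (actions of Player 1), $J$ (actions of Player 2), a payoff function $g:K\times I\times J\to[0,1]$ and a transition function $q:K\times I\times J\to\Delta(K)$. Given an initial state $k_1\in K$, at each stage $m\ge1$ the players simultaneously and independently choose $i_m\in I$, $j_m\in J$; the stage payoff (to Player 1) is $g_m=g(k_m,i_m,j_m)$; the next state $k_{m+1}$ is drawn from $q(k_m,i_m,j_m)$, and $(k_{m+1},i_m,j_m)$ is publicly announced. Histories before stage $m$ form $H_m=(K\times I\times J)^{m-1}\times K$. A behavioral strategy of Player 1 (resp. 2) is a map $\sigma:\bigcup_{m\ge1}H_m\to\Delta(I)$ (resp. $\tau:\bigcup_{m\ge1}H_m\to\Delta(J)$); the sets of these are $\Sigma$, $\mathcal{T}$. A triple $(k_1,\sigma,\tau)$ induces a probability $\mathbb{P}^{k_1}_{\sigma,\tau}$ on infinite plays, with expectation $\mathbb{E}^{k_1}_{\sigma,\tau}$. Values: For $\pi\in\Delta(\mathbb{N}^* )$, $\gamma^{k_1}_\pi(\sigma,\tau)=\mathbb{E}^{k_1}_{\sigma,\tau}\left(\sum_{m\ge1}\pi_m g_m\right)$ and $v_\pi(k_1)=\max_{\sigma\in\Sigma}\min_{\tau\in\mathcal{T}}\gamma^{k_1}_\pi(\sigma,\tau)=\min_{\tau\in\mathcal{T}}\max_{\sigma\in\Sigma}\gamma^{k_1}_\pi(\sigma,\tau)$.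 For $\lambda\in(0,1]$, $v_\lambda$ is $v_\pi$ with $\pi_m=\lambda(1-\lambda)^{m-1}$; for $n\in\mathbb{N}^*$, $v_n$ is $v_\pi$ with $\pi_m=\frac1n 1_{m\le n}$. It is known (Bewley–Kohlberg, Mertens–Neyman) that every finite zero-sum stochastic game has a uniform value $v_\infty:K\to[0,1]$ and $v_\infty=\lim_{\lambda\to0}v_\lambda=\lim_{n\to\infty}v_n$. Impatience: For $\pi\in\Delta(\mathbb{N}^* )$, $I_p(\pi)=\sum_{m\ge1}|(\pi_{m+1})^p-(\pi_m)^p|$ if $p\in(0,+\infty)$, and $I_\infty(\pi)=\sup_{m\ge1}\pi_m$. $p$-asymptotic value: For $p\in(0,+\infty]$, a game has a $p$-asymptotic value if for all $\epsilon>0$ there exists $\alpha>0$ such that for all $\pi\in\Delta(\mathbb{N}^* )$ with $I_p(\pi)\le\alpha$, one has $\|v_\pi-v_\infty\|_\infty=\max_{k\in K}|v_\pi(k)-v_\infty(k)|\le\epsilon$. *)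

theory Defs
  imports "HOL-Probability.Probability"
begin
text \<open>
  The finite sets of states, of actions of Player 1 and of actions of Player 2 are finite types;
  on a finite type \<open>'a\<close>, the probability measures are the elements of \<open>'a pmf\<close>.
  Payoffs are meant to lie in \<open>[0,1]\<close>, as recorded by \<open>game_wf\<close>.
\<close>

record ('k, 'i, 'j) game =
  payoff :: "'k \<Rightarrow> 'i \<Rightarrow> 'j \<Rightarrow> real"
  trans :: "'k \<Rightarrow> 'i \<Rightarrow> 'j \<Rightarrow> 'k pmf"

definition game_wf :: "('k::finite, 'i::finite, 'j::finite) game \<Rightarrow> bool" where
  "game_wf G \<longleftrightarrow> (\<forall>k i j. payoff G k i j \<in> {0..1})"

text \<open>
  A history \<open>(h, k)\<close> consists of the list \<open>h\<close> of past (state, action, action) triples, oldest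
  first, and the current state \<open>k\<close>.
\<close>

type_synonym ('k, 'i, 'j) history = "('k \<times> 'i \<times> 'j) list \<times> 'k"
type_synonym ('k, 'i, 'j) strategy1 = "('k, 'i, 'j) history \<Rightarrow> 'i pmf"
type_synonym ('k, 'i, 'j) strategy2 = "('k, 'i, 'j) history \<Rightarrow> 'j pmf"

text \<open>
  Stages are numbered from 0: index \<open>m\<close> stands for stage \<open>m + 1\<close>, both in plays
  \<open>\<omega> :: nat \<Rightarrow> 'k \<times> 'i \<times> 'j\<close> and in weight sequences \<open>\<pi> :: nat \<Rightarrow> real\<close>.
\<close>

definition state_law ::
    "('k, 'i, 'j) game \<Rightarrow> 'k \<Rightarrow> nat \<Rightarrow> (nat \<Rightarrow> 'k \<times> 'i \<times> 'j) \<Rightarrow> 'k pmf" where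
  "state_law G k1 m \<omega> =
     (case m of 0 \<Rightarrow> return_pmf k1 | Suc l \<Rightarrow> (case \<omega> l of (k, i, j) \<Rightarrow> trans G k i j))"

text \<open>The conditional law of the triple of stage \<open>m\<close> given \<open>\<omega> 0, \<dots>, \<omega> (m - 1)\<close>.\<close>

definition stage_law ::
    "('k, 'i, 'j) game \<Rightarrow> 'k \<Rightarrow> ('k, 'i, 'j) strategy1 \<Rightarrow> ('k, 'i, 'j) strategy2
      \<Rightarrow> nat \<Rightarrow> (nat \<Rightarrow> 'k \<times> 'i \<times> 'j) \<Rightarrow> ('k \<times> 'i \<times> 'j) pmf" where
  "stage_law G k1 \<sigma> \<tau> m \<omega> =
     bind_pmf (state_law G k1 m \<omega>) (\<lambda>k.
       let h = (map \<omega> [0..<m], k)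
       in map_pmf (\<lambda>(i, j). (k, i, j)) (pair_pmf (\<sigma> h) (\<tau> h)))"

abbreviation triple_space :: "nat \<Rightarrow> ('k \<times> 'i \<times> 'j) measure" where
  "triple_space \<equiv> \<lambda>_. count_space UNIV"

lemma Ionescu_Tulcea_stage_law:
  fixes G :: "('k::finite, 'i::finite, 'j::finite) game"
  shows "Ionescu_Tulcea (\<lambda>m \<omega>. measure_pmf (stage_law G k1 \<sigma> \<tau> m \<omega>)) triple_space"
proof
  fix m
  have "countable (UNIV :: ('k \<times> 'i \<times> 'j) set)"
    by (simp add: countable_finite)
  then have eq: "PiM {0..<m} triple_space =
      count_space (PiE {0..<m} (\<lambda>_. UNIV :: ('k \<times> 'i \<times> 'j) set))"
    by (intro count_space_PiM_finite) auto
  show "(\<lambda>\<omega>. measure_pmf (stage_law G k1 \<sigma> \<tau> m \<omega>))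
      \<in> measurable (PiM {0..<m} triple_space) (subprob_algebra (count_space UNIV))"
    unfolding eq measurable_count_space_eq1
    by (intro Pi_I measure_pmf_in_subprob_algebra)
qed

text \<open>
  The law of the infinite play, obtained from the kernels \<open>stage_law\<close> by the Ionescu-Tulcea
  construction.
\<close>

definition play_measure ::
    "('k::finite, 'i::finite, 'j::finite) game \<Rightarrow> 'k \<Rightarrow> ('k, 'i, 'j) strategy1
      \<Rightarrow> ('k, 'i, 'j) strategy2 \<Rightarrow> (nat \<Rightarrow> 'k \<times> 'i \<times> 'j) measure" where
  "play_measure G k1 \<sigma> \<tau> =
     projective_family.lim UNIV
       (Ionescu_Tulcea.CI (\<lambda>m \<omega>. measure_pmf (stage_law G k1 \<sigma> \<tau> m \<omega>)) triple_space)
       triple_space"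

definition stage_payoff :: "('k, 'i, 'j) game \<Rightarrow> 'k \<times> 'i \<times> 'j \<Rightarrow> real" where
  "stage_payoff G = (\<lambda>(k, i, j). payoff G k i j)"

definition weights :: "(nat \<Rightarrow> real) set" where
  "weights = {\<pi>. (\<forall>m. 0 \<le> \<pi> m) \<and> \<pi> sums 1}"

definition weighted_payoff ::
    "('k::finite, 'i::finite, 'j::finite) game \<Rightarrow> (nat \<Rightarrow> real) \<Rightarrow> 'k
      \<Rightarrow> ('k, 'i, 'j) strategy1 \<Rightarrow> ('k, 'i, 'j) strategy2 \<Rightarrow> real" where
  "weighted_payoff G \<pi> k1 \<sigma> \<tau> =
     (\<integral>\<omega>. (\<Sum>m. \<pi> m * stage_payoff G (\<omega> m)) \<partial>play_measure G k1 \<sigma> \<tau>)"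

text \<open>
  The max-min value. For \<open>\<pi> \<in> weights\<close> and \<open>game_wf G\<close> the supremum and the infima are attained,
  and max-min equals min-max.
\<close>

definition game_value ::
    "('k::finite, 'i::finite, 'j::finite) game \<Rightarrow> (nat \<Rightarrow> real) \<Rightarrow> 'k \<Rightarrow> real" where
  "game_value G \<pi> k1 = (SUP \<sigma>. INF \<tau>. weighted_payoff G \<pi> k1 \<sigma> \<tau>)"

definition uniform_weights :: "nat \<Rightarrow> nat \<Rightarrow> real" where
  "uniform_weights n m = (if m < n then 1 / real n else 0)"

definition is_uniform_value ::
    "('k::finite, 'i::finite, 'j::finite) game \<Rightarrow> ('k \<Rightarrow> real) \<Rightarrow> bool" where
  "is_uniform_value G v \<longleftrightarrow>
     (\<forall>k. \<forall>\<epsilon>>0.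
        (\<exists>\<sigma>. \<exists>n0\<ge>1. \<forall>n\<ge>n0. \<forall>\<tau>. v k - \<epsilon> \<le> weighted_payoff G (uniform_weights n) k \<sigma> \<tau>) \<and>
        (\<exists>\<tau>. \<exists>n0\<ge>1. \<forall>n\<ge>n0. \<forall>\<sigma>. weighted_payoff G (uniform_weights n) k \<sigma> \<tau> \<le> v k + \<epsilon>))"

lemma is_uniform_value_le:
  assumes "is_uniform_value G v" "is_uniform_value G w"
  shows "v k \<le> w k"
proof (rule field_le_epsilon)
  fix e :: real assume "0 < e"
  then have e: "e / 2 > 0" by simp
  from assms(1)[unfolded is_uniform_value_def, rule_format, OF e, of k, THEN conjunct1]
  obtain \<sigma> a where a: "\<forall>n\<ge>a. \<forall>\<tau>.
      v k - e / 2 \<le> weighted_payoff G (uniform_weights n) k \<sigma> \<tau>" by (elim exE conjE)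
  from assms(2)[unfolded is_uniform_value_def, rule_format, OF e, of k, THEN conjunct2]
  obtain \<tau> b where b: "\<forall>n\<ge>b. \<forall>\<sigma>.
      weighted_payoff G (uniform_weights n) k \<sigma> \<tau> \<le> w k + e / 2" by (elim exE conjE)
  have "v k - e / 2 \<le> w k + e / 2"
    using a[rule_format, of "max a b" \<tau>] b[rule_format, of "max a b" \<sigma>] by linarith
  then show "v k \<le> w k + e" by simp
qed

lemma is_uniform_value_unique:
  assumes "is_uniform_value G v" "is_uniform_value G w"
  shows "v = w"
proof
  fix k
  show "v k = w k"
    using is_uniform_value_le[OF assms] is_uniform_value_le[OF assms(2,1)] by (rule antisym)
qed

text \<open>Every finite zero-sum stochastic game has a uniform value (Mertens and Neyman).\<close>

definition uniform_value :: "('k::finite, 'i::finite, 'j::finite) game \<Rightarrow> 'k \<Rightarrow> real" where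
  "uniform_value G = (THE v. is_uniform_value G v)"

text \<open>
  The impatience takes values in \<open>ennreal\<close> because for \<open>p < 1\<close> the series may diverge.
\<close>

definition impatience :: "ereal \<Rightarrow> (nat \<Rightarrow> real) \<Rightarrow> ennreal" where
  "impatience p \<pi> =
     (if p = \<infinity> then (SUP m. ennreal (\<pi> m))
      else (\<Sum>m. ennreal \<bar>\<pi> (Suc m) powr real_of_ereal p - \<pi> m powr real_of_ereal p\<bar>))"

text \<open>Intended for \<open>0 < p \<le> \<infinity>\<close>.\<close>

definition has_p_asymptotic_value ::
    "ereal \<Rightarrow> ('k::finite, 'i::finite, 'j::finite) game \<Rightarrow> bool" where
  "has_p_asymptotic_value p G \<longleftrightarrow>
     (\<forall>\<epsilon>>0. \<exists>\<alpha>>0. \<forall>\<pi>\<in>weights. impatience p \<pi> \<le> ennreal \<alpha> \<longrightarrow>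
        (MAX k. \<bar>game_value G \<pi> k - uniform_value G k\<bar>) \<le> \<epsilon>)"

datatype state = Omega1 | Omega2 | One_star | Zero_star
datatype action1 = Top | Middle | Bottom
datatype action2 = Left | Right

instance state :: finite
proof
  have "(UNIV :: state set) = {Omega1, Omega2, One_star, Zero_star}"
    using state.exhaust by blast
  then show "finite (UNIV :: state set)" by (metis finite.emptyI finite_insert)
qed

instance action1 :: finite
proof
  have "(UNIV :: action1 set) = {Top, Middle, Bottom}"
    using action1.exhaust by blast
  then show "finite (UNIV :: action1 set)" by (metis finite.emptyI finite_insert)
qed

instance action2 :: finite
proof
  have "(UNIV :: action2 set) = {Left, Right}"
    using action2.exhaust by blast
  then show "finite (UNIV :: action2 set)" by (metis finite.emptyI finite_insert)
qed

fun Gamma_payoff :: "state \<Rightarrow> action1 \<Rightarrow> action2 \<Rightarrow> real" where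
  "Gamma_payoff Omega1 Top    _ = 1"
| "Gamma_payoff Omega1 Middle _ = 0"
| "Gamma_payoff Omega1 Bottom _ = 1"
| "Gamma_payoff Omega2 _ _ = 0"
| "Gamma_payoff One_star _ _ = 1"
| "Gamma_payoff Zero_star _ _ = 0"

fun Gamma_next :: "state \<Rightarrow> action1 \<Rightarrow> action2 \<Rightarrow> state" where
  "Gamma_next Omega1 Top    Left  = Omega1"
| "Gamma_next Omega1 Top    Right = Omega2"
| "Gamma_next Omega1 Middle _     = Omega1"
| "Gamma_next Omega1 Bottom Left  = Omega2"
| "Gamma_next Omega1 Bottom Right = One_star"
| "Gamma_next Omega2 Top    Left  = Omega2"
| "Gamma_next Omega2 Top    Right = Omega1"
| "Gamma_next Omega2 Middle _     = Omega2"
| "Gamma_next Omega2 Bottom Left  = Omega1"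
| "Gamma_next Omega2 Bottom Right = Zero_star"
| "Gamma_next One_star  _ _ = One_star"
| "Gamma_next Zero_star _ _ = Zero_star"

definition Gamma_game :: "(state, action1, action2) game" where
  "Gamma_game = \<lparr>payoff = Gamma_payoff, trans = (\<lambda>k i j. return_pmf (Gamma_next k i j))\<rparr>"

lemma game_wf_Gamma_game: "game_wf Gamma_game"
proof -
  have "Gamma_payoff k i j \<in> {0..1}" for k i j
    by (cases k; cases i) simp_all
  then show ?thesis unfolding game_wf_def Gamma_game_def by simp
qed

end

theory Submission
  imports Defs "HOL-Real_Asymp.Real_Asymp"
begin

text \<open>
  Two families of arbitrarily patient weights are exhibited whose values at \<open>Omega1\<close> stay on
  different sides of the gap between \<open>5 / 8\<close> and \<open>3 / 4\<close>. They cannot both approach one number,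
  whatever that number is.

  In \<open>Omega1\<close>, Player 1 earns while the game stays there, and Player 2 wants to leave. Playing
  \<open>Right\<close>, she leaves at once, but when Player 1 plays \<open>Bottom\<close>, with probability \<open>x\<close> say, she is
  caught in the absorbing state \<open>One_star\<close>. This threat has a price: against \<open>Left\<close>, it is \<open>Bottom\<close>
  that moves the game to \<open>Omega2\<close>. The state \<open>Omega2\<close> is symmetric: now Player 1 wants to leave,
  and the risk of absorption in \<open>Zero_star\<close> is his. When the stage weight is about \<open>w\<close>, the
  advantage of being in \<open>Omega1\<close> rather than \<open>Omega2\<close> is of order \<open>sqrt w\<close>.

  If the weights vary slowly, the two states balance each other. For the discount rate \<open>s\<^sup>2\<close>,
  Player 2 plays \<open>Right\<close> with probability \<open>s\<close> in both states, and this keeps the value at most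
  \<open>5 / 8\<close> (\<open>game_value_discounted_le\<close>).

  The action \<open>Middle\<close>, which freezes the state, breaks the balance when the weight keeps jumping
  between a constant \<open>w\<close> and \<open>0\<close>. During a long idle block, Player 1 freezes \<open>Omega1\<close> for free,
  and in \<open>Omega2\<close> he has so much time to return to \<open>Omega1\<close> that a small risk of \<open>Zero_star\<close>
  suffices. Hence he mostly starts active blocks in \<open>Omega1\<close>. If active blocks have length \<open>l\<close> and
  there are \<open>64 * l\<close> of them, then a probability of \<open>Bottom\<close> that is large enough to deter
  \<open>Right\<close> makes him leave, against \<open>Left\<close>, during an active block with probability at most
  \<open>1 / 8\<close>, and he secures \<open>3 / 4\<close> (\<open>game_value_block_ge\<close>).

  These weights jump \<open>O(l)\<close> times, between \<open>0\<close> and \<open>w = 1 / (64 * l\<^sup>2)\<close>. For finite \<open>p\<close>, their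
  impatience is of order \<open>l powr (1 - 2 * p)\<close>, which tends to \<open>0\<close> as \<open>l\<close> grows exactly when \<open>p > 1 / 2\<close>
  (\<open>block_weights_arbitrarily_patient\<close>).

  Both bounds on values come from one principle: a function of stage and state that Player 1's
  strategy keeps from decreasing on average, whatever Player 2 does, and that is eventually almost
  nonpositive, cannot start above the expected payoff (\<open>payoff_series_ge_potential\<close>). With signs
  reversed, the same holds for Player 2.
\<close>

section \<open>The law of a play, one stage at a time\<close>

lemma state_law_cong:
  assumes "\<And>i. i < n \<Longrightarrow> \<omega> i = \<omega>' i"
  shows "state_law G k1 n \<omega> = state_law G k1 n \<omega>'"
  using assms unfolding state_law_def by (cases n) auto

lemma stage_law_cong:
  assumes "\<And>i. i < n \<Longrightarrow> \<omega> i = \<omega>' i"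
  shows "stage_law G k1 \<sigma> \<tau> n \<omega> = stage_law G k1 \<sigma> \<tau> n \<omega>'"
proof -
  have "state_law G k1 n \<omega> = state_law G k1 n \<omega>'"
    using assms by (rule state_law_cong)
  moreover have "map \<omega> [0..<n] = map \<omega>' [0..<n]"
    using assms by (intro map_cong) auto
  ultimately show ?thesis unfolding stage_law_def by (simp only:)
qed

lemma sets_play_measure [measurable_cong]:
  "sets (play_measure G k1 \<sigma> \<tau>) = sets (PiM UNIV triple_space)"
proof -
  interpret Ionescu_Tulcea "\<lambda>m \<omega>. measure_pmf (stage_law G k1 \<sigma> \<tau> m \<omega>)" triple_space
    by (rule Ionescu_Tulcea_stage_law)
  show ?thesis unfolding play_measure_def by simp
qed

lemma prob_space_play_measure: "prob_space (play_measure G k1 \<sigma> \<tau>)"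
proof -
  interpret Ionescu_Tulcea "\<lambda>m \<omega>. measure_pmf (stage_law G k1 \<sigma> \<tau> m \<omega>)" triple_space
    by (rule Ionescu_Tulcea_stage_law)
  have "prob_space (distr PF.lim (PiM {} triple_space) (\<lambda>x. restrict x {}))"
    by (subst distr_lim) (auto intro: PF.prob_space_P)
  then show ?thesis unfolding play_measure_def
    by (rule prob_space_distrD[rotated]) (auto simp: measurable_cong_sets[OF PF.sets_lim refl] intro!: measurable_restrict)
qed

text \<open>
  The defining property of the law of the play: \<open>stage_law\<close> is the conditional law of stage \<open>n\<close>
  given the past. It is read off the finite-dimensional distributions, which the Ionescu-Tulcea
  construction builds by composing the kernels \<open>stage_law\<close>.
\<close>

lemma nn_integral_play_measure_stage:
  fixes G :: "('k::finite, 'i::finite, 'j::finite) game" and \<phi> :: "'k \<times> 'i \<times> 'j \<Rightarrow> ennreal"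
  shows "(\<integral>\<^sup>+\<omega>. \<phi> (\<omega> n) \<partial>play_measure G k1 \<sigma> \<tau>)
    = (\<integral>\<^sup>+\<omega>. (\<integral>\<^sup>+z. \<phi> z \<partial>stage_law G k1 \<sigma> \<tau> n \<omega>) \<partial>play_measure G k1 \<sigma> \<tau>)"
proof -
  interpret Ionescu_Tulcea "\<lambda>m \<omega>. measure_pmf (stage_law G k1 \<sigma> \<tau> m \<omega>)" "triple_space :: nat \<Rightarrow> ('k \<times> 'i \<times> 'j) measure"
    by (rule Ionescu_Tulcea_stage_law)
  let ?P = "play_measure G k1 \<sigma> \<tau>"
  have lim_eq: "?P = PF.lim" by (simp add: play_measure_def)
  have up_to: "up_to {0..<m} = m" for m
    by (rule antisym) (use up_to[of "{0..<m}"] in \<open>auto simp: up_to_iff_Ico\<close>)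
  have C: "C 0 m (\<lambda>_. undefined) = distr ?P (PiM {0..<m} triple_space) (\<lambda>x. restrict x {0..<m})" for m
    unfolding lim_eq by (subst distr_lim) (auto simp: CI_def up_to distr_C[of m m _ 0, simplified, symmetric])
  have [measurable]: "(\<lambda>x. restrict x {0..<m}) \<in> measurable ?P (PiM {0..<m} triple_space)" for m
    by (auto simp: measurable_cong_sets[OF sets_play_measure refl] intro!: measurable_restrict)
  have m1: "(\<lambda>x. \<phi> (x n)) \<in> borel_measurable (PiM {0..<Suc n} triple_space)"
    by (rule measurable_compose[OF measurable_component_singleton]) auto
  have m2: "(\<lambda>\<omega>. \<integral>\<^sup>+z. \<phi> z \<partial>stage_law G k1 \<sigma> \<tau> n \<omega>) \<in> borel_measurable (PiM {0..<n} triple_space)"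
    by (rule measurable_compose[OF P nn_integral_measurable_subprob_algebra]) auto
  have "(\<integral>\<^sup>+\<omega>. \<phi> (\<omega> n) \<partial>?P) = (\<integral>\<^sup>+\<omega>. \<phi> (\<omega> n) \<partial>C 0 (Suc n) (\<lambda>_. undefined))"
    unfolding C using m1 by (subst nn_integral_distr) auto
  also have "\<dots> = (\<integral>\<^sup>+\<omega>. (\<integral>\<^sup>+\<omega>'. \<phi> (\<omega>' n) \<partial>eP n \<omega>) \<partial>C 0 n (\<lambda>_. undefined))"
    using m1 by (simp, subst nn_integral_bind[where B="PiM {0..<Suc n} triple_space"])
      (auto simp: measurable_cong_sets[OF sets_C refl])
  also have "\<dots> = (\<integral>\<^sup>+\<omega>. (\<integral>\<^sup>+z. \<phi> z \<partial>stage_law G k1 \<sigma> \<tau> n \<omega>) \<partial>C 0 n (\<lambda>_. undefined))"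
    using m1 by (intro nn_integral_cong) (simp add: space_C nn_integral_eP)
  also have "\<dots> = (\<integral>\<^sup>+\<omega>. (\<integral>\<^sup>+z. \<phi> z \<partial>stage_law G k1 \<sigma> \<tau> n (restrict \<omega> {0..<n})) \<partial>?P)"
    unfolding C using m2 by (subst nn_integral_distr) auto
  also have "\<dots> = (\<integral>\<^sup>+\<omega>. (\<integral>\<^sup>+z. \<phi> z \<partial>stage_law G k1 \<sigma> \<tau> n \<omega>) \<partial>?P)"
    by (intro nn_integral_cong arg_cong2[where f=nn_integral] arg_cong[where f=measure_pmf] stage_law_cong) auto
  finally show ?thesis .
qed

text \<open>
  There are finitely many triples, so a function of finitely many stages takes finitely many values
  on a discrete space, and it is integrable without further assumptions.
\<close>

lemma measurable_prefix:
  fixes F :: "(nat \<Rightarrow> 'k::finite \<times> 'i::finite \<times> 'j::finite) \<Rightarrow> real"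
  assumes "\<And>\<omega> \<omega>'. (\<And>i. i < n \<Longrightarrow> \<omega> i = \<omega>' i) \<Longrightarrow> F \<omega> = F \<omega>'"
  shows "F \<in> borel_measurable (play_measure G k1 \<sigma> \<tau>)"
proof -
  have "countable (UNIV :: ('k \<times> 'i \<times> 'j) set)"
    by (simp add: countable_finite)
  then have eq: "PiM {0..<n} triple_space =
      count_space (PiE {0..<n} (\<lambda>_. UNIV :: ('k \<times> 'i \<times> 'j) set))"
    by (intro count_space_PiM_finite) auto
  have "(\<lambda>\<omega>. restrict \<omega> {0..<n}) \<in> measurable (play_measure G k1 \<sigma> \<tau>) (PiM {0..<n} triple_space)"
    by (auto simp: measurable_cong_sets[OF sets_play_measure refl] intro!: measurable_restrict)
  moreover have "F \<in> borel_measurable (PiM {0..<n} triple_space)"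
    unfolding eq by simp
  ultimately have "(\<lambda>\<omega>. F (restrict \<omega> {0..<n})) \<in> borel_measurable (play_measure G k1 \<sigma> \<tau>)"
    by (rule measurable_compose)
  moreover have "(\<lambda>\<omega>. F (restrict \<omega> {0..<n})) = F"
    by (intro ext assms) auto
  ultimately show ?thesis by simp
qed

lemma integrable_prefix:
  fixes F :: "(nat \<Rightarrow> 'k::finite \<times> 'i::finite \<times> 'j::finite) \<Rightarrow> real"
  assumes "\<And>\<omega> \<omega>'. (\<And>i. i < n \<Longrightarrow> \<omega> i = \<omega>' i) \<Longrightarrow> F \<omega> = F \<omega>'"
  shows "integrable (play_measure G k1 \<sigma> \<tau>) F"
proof -
  interpret prob_space "play_measure G k1 \<sigma> \<tau>"
    by (rule prob_space_play_measure)
  have "range F \<subseteq> F ` PiE {0..<n} (\<lambda>_. UNIV)"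
  proof safe
    fix \<omega> show "F \<omega> \<in> F ` PiE {0..<n} (\<lambda>_. UNIV)"
      by (rule image_eqI[of _ _ "restrict \<omega> {0..<n}"]) (auto intro!: assms)
  qed
  moreover have "finite (F ` PiE {0..<n} (\<lambda>_. UNIV))"
    by (intro finite_imageI finite_PiE) auto
  ultimately have "finite (range F)" by (rule finite_subset)
  then obtain B where "\<And>\<omega>. norm (F \<omega>) \<le> B"
    by (meson finite_imp_bounded bounded_iff rangeI)
  then show ?thesis
    by (intro integrable_const_bound[of _ B] measurable_prefix[of n] assms) auto
qed

lemma integral_play_measure_stage:
  fixes G :: "('k::finite, 'i::finite, 'j::finite) game" and \<phi> :: "'k \<times> 'i \<times> 'j \<Rightarrow> real"
  shows "(\<integral>\<omega>. \<phi> (\<omega> n) \<partial>play_measure G k1 \<sigma> \<tau>)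
    = (\<integral>\<omega>. (\<integral>z. \<phi> z \<partial>stage_law G k1 \<sigma> \<tau> n \<omega>) \<partial>play_measure G k1 \<sigma> \<tau>)"
proof -
  let ?P = "play_measure G k1 \<sigma> \<tau>"
  interpret prob_space ?P by (rule prob_space_play_measure)
  \<comment> \<open>Adding a constant makes the function nonnegative, which reduces the claim to the previous one.\<close>
  define c where "c = Max (range (\<lambda>z. - \<phi> z))"
  have c: "0 \<le> \<phi> z + c" for z
  proof -
    have "- \<phi> z \<le> c" unfolding c_def by (rule Max_ge) auto
    then show ?thesis by simp
  qed
  have int: "integrable ?P (\<lambda>\<omega>. \<phi> (\<omega> n))"
    by (rule integrable_prefix[of "Suc n"]) auto
  have int': "integrable ?P (\<lambda>\<omega>. \<integral>z. \<phi> z \<partial>stage_law G k1 \<sigma> \<tau> n \<omega>)"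
    by (rule integrable_prefix[of n])
      (intro arg_cong2[where f="integral\<^sup>L"] arg_cong[where f=measure_pmf] stage_law_cong, auto)
  have fin: "integrable (measure_pmf M) g" for M :: "('k \<times> 'i \<times> 'j) pmf" and g :: "_ \<Rightarrow> real"
    by (rule integrable_measure_pmf_finite) simp
  have shift: "(\<integral>z. \<phi> z + c \<partial>measure_pmf M) = (\<integral>z. \<phi> z \<partial>measure_pmf M) + c" for M
    by (simp add: fin)
  have "ennreal (\<integral>\<omega>. \<phi> (\<omega> n) + c \<partial>?P) = (\<integral>\<^sup>+\<omega>. ennreal (\<phi> (\<omega> n) + c) \<partial>?P)"
    using int c by (intro nn_integral_eq_integral[symmetric]) auto
  also have "\<dots> = (\<integral>\<^sup>+\<omega>. (\<integral>\<^sup>+z. ennreal (\<phi> z + c) \<partial>stage_law G k1 \<sigma> \<tau> n \<omega>) \<partial>?P)"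
    by (rule nn_integral_play_measure_stage[where \<phi> = "\<lambda>z. ennreal (\<phi> z + c)"])
  also have "\<dots> = (\<integral>\<^sup>+\<omega>. ennreal (\<integral>z. \<phi> z + c \<partial>stage_law G k1 \<sigma> \<tau> n \<omega>) \<partial>?P)"
    using c fin by (intro nn_integral_cong nn_integral_eq_integral) auto
  also have "\<dots> = ennreal (\<integral>\<omega>. (\<integral>z. \<phi> z + c \<partial>stage_law G k1 \<sigma> \<tau> n \<omega>) \<partial>?P)"
    using c int' by (intro nn_integral_eq_integral) (auto simp: shift[symmetric] intro!: integral_nonneg_AE, simp add: shift)
  finally have "(\<integral>\<omega>. \<phi> (\<omega> n) + c \<partial>?P) = (\<integral>\<omega>. (\<integral>z. \<phi> z + c \<partial>stage_law G k1 \<sigma> \<tau> n \<omega>) \<partial>?P)"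
    using c by (subst (asm) ennreal_inj) (auto intro!: integral_nonneg_AE)
  then show ?thesis
    using int int' by (simp add: shift prob_space)
qed

lemma integral_bind_pmf_finite:
  fixes p :: "'a::finite pmf" and f :: "'a \<Rightarrow> 'b::finite pmf" and h :: "'b \<Rightarrow> real"
  shows "(\<integral>z. h z \<partial>bind_pmf p f) = (\<integral>x. (\<integral>z. h z \<partial>f x) \<partial>p)"
  by (subst pmf_expectation_bind[of UNIV]) (auto simp: integral_measure_pmf[of UNIV])

lemma integral_stage_law:
  fixes G :: "('k::finite, 'i::finite, 'j::finite) game" and \<phi> :: "'k \<times> 'i \<times> 'j \<Rightarrow> real"
    and \<sigma> :: "('k, 'i, 'j) strategy1" and \<tau> :: "('k, 'i, 'j) strategy2"
  shows "(\<integral>z. \<phi> z \<partial>stage_law G k1 \<sigma> \<tau> n \<omega>)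
    = (\<integral>k. (\<integral>i. (\<integral>j. \<phi> (k, i, j) \<partial>\<tau> (map \<omega> [0..<n], k)) \<partial>\<sigma> (map \<omega> [0..<n], k))
        \<partial>state_law G k1 n \<omega>)"
  unfolding stage_law_def Let_def pair_pmf_def
  by (simp add: integral_bind_pmf_finite case_prod_beta)

section \<open>Bounding values by potentials\<close>

text \<open>
  The hypothesis says that payoff received so far plus potential of the current state is a
  submartingale along the play. The state of stage \<open>n\<close> is not yet a coordinate of the play before
  stage \<open>n\<close>; hence the average over \<open>state_law\<close>.
\<close>

lemma expectation_ge_potential:
  fixes G :: "('k::finite, 'i::finite, 'j::finite) game" and f :: "nat \<Rightarrow> 'k \<times> 'i \<times> 'j \<Rightarrow> real"
    and \<sigma> :: "('k, 'i, 'j) strategy1" and \<tau> :: "('k, 'i, 'j) strategy2"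
  assumes step: "\<And>h k. u (length h) k \<le> (\<integral>i. (\<integral>j. f (length h) (k, i, j)
      + (\<integral>k'. u (Suc (length h)) k' \<partial>trans G k i j) \<partial>\<tau> (h, k)) \<partial>\<sigma> (h, k))"
  shows "u 0 k1 \<le> (\<integral>\<omega>. (\<Sum>m<n. f m (\<omega> m)) + (\<integral>k. u n k \<partial>state_law G k1 n \<omega>)
      \<partial>play_measure G k1 \<sigma> \<tau>)"
proof (induction n)
  case 0
  interpret prob_space "play_measure G k1 \<sigma> \<tau>" by (rule prob_space_play_measure)
  show ?case by (simp add: state_law_def prob_space)
next
  case (Suc n)
  let ?P = "play_measure G k1 \<sigma> \<tau>"
  define \<phi> where "\<phi> = (\<lambda>(k, i, j). f n (k, i, j) + (\<integral>k'. u (Suc n) k' \<partial>trans G k i j))"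
  have fin: "integrable (measure_pmf M) g" for M :: "'k pmf" and g :: "_ \<Rightarrow> real"
    by (rule integrable_measure_pmf_finite) simp
  have int_sum: "integrable ?P (\<lambda>\<omega>. \<Sum>m<n. f m (\<omega> m))"
    by (rule integrable_prefix[of n]) (auto intro!: sum.cong)
  have int_u: "integrable ?P (\<lambda>\<omega>. \<integral>k. u n k \<partial>state_law G k1 n \<omega>)"
    by (rule integrable_prefix[of n]) (metis state_law_cong)
  have int_stage: "integrable ?P (\<lambda>\<omega>. \<integral>z. \<phi> z \<partial>stage_law G k1 \<sigma> \<tau> n \<omega>)"
    by (rule integrable_prefix[of n]) (metis stage_law_cong)
  have int_\<phi>: "integrable ?P (\<lambda>\<omega>. \<phi> (\<omega> n))"
    by (rule integrable_prefix[of "Suc n"]) auto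
  have "u 0 k1 \<le> (\<integral>\<omega>. (\<Sum>m<n. f m (\<omega> m)) + (\<integral>k. u n k \<partial>state_law G k1 n \<omega>) \<partial>?P)"
    by (rule Suc.IH)
  also have "\<dots> \<le> (\<integral>\<omega>. (\<Sum>m<n. f m (\<omega> m)) + (\<integral>z. \<phi> z \<partial>stage_law G k1 \<sigma> \<tau> n \<omega>) \<partial>?P)"
  proof (intro integral_mono Bochner_Integration.integrable_add int_sum int_u int_stage add_left_mono)
    fix \<omega>
    show "(\<integral>k. u n k \<partial>state_law G k1 n \<omega>) \<le> (\<integral>z. \<phi> z \<partial>stage_law G k1 \<sigma> \<tau> n \<omega>)"
      unfolding integral_stage_law \<phi>_def using step[of "map \<omega> [0..<n]"]
      by (intro integral_mono fin) simp
  qed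
  also have "\<dots> = (\<integral>\<omega>. (\<Sum>m<n. f m (\<omega> m)) + \<phi> (\<omega> n) \<partial>?P)"
    using int_sum int_stage int_\<phi> integral_play_measure_stage[where \<phi> = \<phi>] by simp
  also have "\<dots> = (\<integral>\<omega>. (\<Sum>m<Suc n. f m (\<omega> m)) + (\<integral>k. u (Suc n) k \<partial>state_law G k1 (Suc n) \<omega>) \<partial>?P)"
    by (intro Bochner_Integration.integral_cong) (auto simp: \<phi>_def state_law_def split: prod.splits)
  finally show ?case .
qed

lemma payoff_series_ge_potential:
  fixes G :: "('k::finite, 'i::finite, 'j::finite) game" and f :: "nat \<Rightarrow> 'k \<times> 'i \<times> 'j \<Rightarrow> real"
    and \<sigma> :: "('k, 'i, 'j) strategy1" and \<tau> :: "('k, 'i, 'j) strategy2"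
  assumes step: "\<And>h k. u (length h) k \<le> (\<integral>i. (\<integral>j. f (length h) (k, i, j)
      + (\<integral>k'. u (Suc (length h)) k' \<partial>trans G k i j) \<partial>\<tau> (h, k)) \<partial>\<sigma> (h, k))"
    and final: "\<And>\<epsilon>. 0 < \<epsilon> \<Longrightarrow> \<forall>\<^sub>F n in sequentially. \<forall>k. u n k \<le> \<epsilon>"
    and f: "\<And>m z. \<bar>f m z\<bar> \<le> b m" and b: "summable b"
  shows "u 0 k1 \<le> (\<integral>\<omega>. (\<Sum>m. f m (\<omega> m)) \<partial>play_measure G k1 \<sigma> \<tau>)"
proof -
  let ?P = "play_measure G k1 \<sigma> \<tau>"
  interpret prob_space ?P by (rule prob_space_play_measure)
  have fin: "integrable (measure_pmf M) g" for M :: "'k pmf" and g :: "_ \<Rightarrow> real"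
    by (rule integrable_measure_pmf_finite) simp
  have int_sum: "integrable ?P (\<lambda>\<omega>. \<Sum>m<n. f m (\<omega> m))" for n
    by (rule integrable_prefix[of n]) (auto intro!: sum.cong)
  have int_u: "integrable ?P (\<lambda>\<omega>. \<integral>k. u n k \<partial>state_law G k1 n \<omega>)" for n
    by (rule integrable_prefix[of n]) (metis state_law_cong)
  have summable_f: "summable (\<lambda>m. f m (\<omega> m))" for \<omega>
    using f by (intro summable_comparison_test'[OF b, of 0]) auto
  have b0: "0 \<le> b m" for m
    using f[of m] abs_ge_zero order_trans by blast
  have lim: "(\<lambda>n. \<integral>\<omega>. (\<Sum>m<n. f m (\<omega> m)) \<partial>?P) \<longlonglongrightarrow> (\<integral>\<omega>. (\<Sum>m. f m (\<omega> m)) \<partial>?P)"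
  proof (rule integral_dominated_convergence[where w="\<lambda>_. suminf b"])
    show "(\<lambda>\<omega>. \<Sum>m<n. f m (\<omega> m)) \<in> borel_measurable ?P" for n
      using int_sum by blast
    show "(\<lambda>\<omega>. \<Sum>m. f m (\<omega> m)) \<in> borel_measurable ?P"
    proof (rule borel_measurable_suminf)
      show "(\<lambda>\<omega>. f m (\<omega> m)) \<in> borel_measurable ?P" for m
        by (rule measurable_prefix[of "Suc m"]) auto
    qed
    show "AE \<omega> in ?P. (\<lambda>n. \<Sum>m<n. f m (\<omega> m)) \<longlonglongrightarrow> (\<Sum>m. f m (\<omega> m))"
      using summable_f by (simp add: summable_LIMSEQ)
    show "AE \<omega> in ?P. norm (\<Sum>m<n. f m (\<omega> m)) \<le> suminf b" for n
    proof (rule AE_I2)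
      fix \<omega>
      have "norm (\<Sum>m<n. f m (\<omega> m)) \<le> (\<Sum>m<n. b m)"
        using f by (intro sum_norm_le) auto
      also have "\<dots> \<le> suminf b"
        using b b0 by (intro sum_le_suminf) auto
      finally show "norm (\<Sum>m<n. f m (\<omega> m)) \<le> suminf b" .
    qed
  qed simp
  show ?thesis
  proof (rule field_le_epsilon)
    fix \<epsilon> :: real assume \<epsilon>: "0 < \<epsilon>"
    have "\<forall>\<^sub>F n in sequentially. u 0 k1 - \<epsilon> \<le> (\<integral>\<omega>. (\<Sum>m<n. f m (\<omega> m)) \<partial>?P)"
      using final[OF \<epsilon>]
    proof eventually_elim
      case (elim n)
      have "u 0 k1 \<le> (\<integral>\<omega>. (\<Sum>m<n. f m (\<omega> m)) + (\<integral>k. u n k \<partial>state_law G k1 n \<omega>) \<partial>?P)"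
        using step by (rule expectation_ge_potential)
      also have "\<dots> \<le> (\<integral>\<omega>. (\<Sum>m<n. f m (\<omega> m)) + \<epsilon> \<partial>?P)"
      proof (intro integral_mono Bochner_Integration.integrable_add int_sum int_u add_left_mono integrable_const)
        fix \<omega>
        have "(\<integral>k. u n k \<partial>state_law G k1 n \<omega>) \<le> (\<integral>k. \<epsilon> \<partial>state_law G k1 n \<omega>)"
          using elim by (intro integral_mono fin) auto
        then show "(\<integral>k. u n k \<partial>state_law G k1 n \<omega>) \<le> \<epsilon>" by simp
      qed
      also have "\<dots> = (\<integral>\<omega>. (\<Sum>m<n. f m (\<omega> m)) \<partial>?P) + \<epsilon>"
        using int_sum by (simp add: prob_space)
      finally show ?case by simp
    qed
    then have "u 0 k1 - \<epsilon> \<le> (\<integral>\<omega>. (\<Sum>m. f m (\<omega> m)) \<partial>?P)"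
      by (intro tendsto_lowerbound[OF lim]) auto
    then show "u 0 k1 \<le> (\<integral>\<omega>. (\<Sum>m. f m (\<omega> m)) \<partial>?P) + \<epsilon>" by simp
  qed
qed

lemma weighted_payoff_bounds:
  assumes G: "game_wf G" and \<pi>: "\<pi> \<in> weights"
  shows "0 \<le> weighted_payoff G \<pi> k1 \<sigma> \<tau>" "weighted_payoff G \<pi> k1 \<sigma> \<tau> \<le> 1"
proof -
  interpret prob_space "play_measure G k1 \<sigma> \<tau>" by (rule prob_space_play_measure)
  have pos: "0 \<le> \<pi> m" and sm: "summable \<pi>" and sum1: "suminf \<pi> = 1" for m
    using \<pi> by (auto simp: weights_def sums_iff)
  have g: "0 \<le> stage_payoff G z" "stage_payoff G z \<le> 1" for z
    using G by (auto simp: game_wf_def stage_payoff_def split: prod.splits)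
  have weighted: "0 \<le> \<pi> m * stage_payoff G (\<omega> m)" "\<pi> m * stage_payoff G (\<omega> m) \<le> \<pi> m" for m \<omega>
    using pos[of m] g[of "\<omega> m"] by (auto simp: mult_left_le)
  have sm': "summable (\<lambda>m. \<pi> m * stage_payoff G (\<omega> m))" for \<omega>
    using weighted by (intro summable_comparison_test'[OF sm, of 0]) auto
  have s0: "0 \<le> (\<Sum>m. \<pi> m * stage_payoff G (\<omega> m))" for \<omega>
    using sm' weighted by (intro suminf_nonneg) auto
  have s1: "(\<Sum>m. \<pi> m * stage_payoff G (\<omega> m)) \<le> 1" for \<omega>
    using suminf_le[OF weighted(2) sm' sm] sum1 by simp
  show "0 \<le> weighted_payoff G \<pi> k1 \<sigma> \<tau>"
    unfolding weighted_payoff_def using s0 by (intro integral_nonneg_AE) auto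
  show "weighted_payoff G \<pi> k1 \<sigma> \<tau> \<le> 1"
  proof (cases "integrable (play_measure G k1 \<sigma> \<tau>) (\<lambda>\<omega>. \<Sum>m. \<pi> m * stage_payoff G (\<omega> m))")
    case True
    then show ?thesis unfolding weighted_payoff_def using s1 by (intro integral_le_const) auto
  next
    case False
    then show ?thesis unfolding weighted_payoff_def by (simp add: not_integrable_integral_eq)
  qed
qed

text \<open>
  In the two criteria below, a player follows a strategy that looks only at the stage and the
  current state. Against it, the opponent's mixtures and memory are of no use: an inequality that
  holds for each of the opponent's actions survives averaging over them.
\<close>

lemma integral_pmf_swap:
  fixes p :: "'a::finite pmf" and q :: "'b::finite pmf" and F :: "'a \<Rightarrow> 'b \<Rightarrow> real"
  shows "(\<integral>x. (\<integral>y. F x y \<partial>q) \<partial>p) = (\<integral>y. (\<integral>x. F x y \<partial>p) \<partial>q)"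
proof -
  have "(\<Sum>x\<in>UNIV. \<Sum>y\<in>UNIV. pmf p x * (pmf q y * F x y))
      = (\<Sum>y\<in>UNIV. \<Sum>x\<in>UNIV. pmf q y * (pmf p x * F x y))"
    by (subst sum.swap) (simp add: mult.left_commute)
  then show ?thesis
    by (simp add: integral_measure_pmf[of UNIV] sum_distrib_left)
qed

lemma integral_pmf_finite_mono:
  fixes p :: "'a::finite pmf" and f g :: "'a \<Rightarrow> real"
  assumes "\<And>x. f x \<le> g x"
  shows "(\<integral>x. f x \<partial>p) \<le> (\<integral>x. g x \<partial>p)"
  by (intro integral_mono integrable_measure_pmf_finite assms) auto

theorem game_value_ge_potential:
  fixes G :: "('k::finite, 'i::finite, 'j::finite) game" and s :: "nat \<Rightarrow> 'k \<Rightarrow> 'i pmf"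
  assumes G: "game_wf G" and \<pi>: "\<pi> \<in> weights"
    and step: "\<And>m k j. u m k \<le> (\<integral>i. \<pi> m * payoff G k i j
        + (\<integral>k'. u (Suc m) k' \<partial>trans G k i j) \<partial>s m k)"
    and final: "\<And>\<epsilon>. 0 < \<epsilon> \<Longrightarrow> \<forall>\<^sub>F n in sequentially. \<forall>k. u n k \<le> \<epsilon>"
  shows "u 0 k1 \<le> game_value G \<pi> k1"
proof -
  note bounds = weighted_payoff_bounds[OF G \<pi>]
  let ?\<sigma> = "\<lambda>(h, k). s (length h) k"
  have weighted: "\<bar>\<pi> m * stage_payoff G z\<bar> \<le> \<pi> m" for m z
    using G \<pi> by (cases z) (simp add: weights_def game_wf_def stage_payoff_def abs_mult mult_left_le)
  have "u 0 k1 \<le> weighted_payoff G \<pi> k1 ?\<sigma> \<tau>" for \<tau> :: "('k, 'i, 'j) strategy2"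
    unfolding weighted_payoff_def
  proof (rule payoff_series_ge_potential[where b = \<pi>])
    fix h :: "('k \<times> 'i \<times> 'j) list" and k
    have "u (length h) k = (\<integral>j. u (length h) k \<partial>\<tau> (h, k))" by simp
    also have "\<dots> \<le> (\<integral>j. (\<integral>i. \<pi> (length h) * payoff G k i j
        + (\<integral>k'. u (Suc (length h)) k' \<partial>trans G k i j) \<partial>s (length h) k) \<partial>\<tau> (h, k))"
      by (intro integral_pmf_finite_mono step)
    finally show "u (length h) k \<le> (\<integral>i. (\<integral>j. \<pi> (length h) * stage_payoff G (k, i, j)
        + (\<integral>k'. u (Suc (length h)) k' \<partial>trans G k i j) \<partial>\<tau> (h, k)) \<partial>(?\<sigma> (h, k)))"
      by (subst integral_pmf_swap) (simp add: stage_payoff_def)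
  qed (use final weighted \<pi> in \<open>auto simp: weights_def sums_iff\<close>)
  then have "u 0 k1 \<le> (INF \<tau>. weighted_payoff G \<pi> k1 ?\<sigma> \<tau>)"
    by (intro cINF_greatest) auto
  also have "\<dots> \<le> game_value G \<pi> k1"
    unfolding game_value_def
  proof (rule cSUP_upper)
    have "(INF \<tau>. weighted_payoff G \<pi> k1 \<sigma> \<tau>) \<le> 1" for \<sigma>
      by (rule cINF_lower2[of _ _ undefined]) (auto intro!: bounds bdd_belowI2)
    then show "bdd_above (range (\<lambda>\<sigma>. INF \<tau>. weighted_payoff G \<pi> k1 \<sigma> \<tau>))"
      by (intro bdd_aboveI2) auto
  qed simp
  finally show ?thesis .
qed

text \<open>The previous argument, applied to the negated payoff.\<close>

theorem game_value_le_potential: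
  fixes G :: "('k::finite, 'i::finite, 'j::finite) game" and t :: "nat \<Rightarrow> 'k \<Rightarrow> 'j pmf"
  assumes G: "game_wf G" and \<pi>: "\<pi> \<in> weights"
    and step: "\<And>m k i. (\<integral>j. \<pi> m * payoff G k i j
        + (\<integral>k'. u (Suc m) k' \<partial>trans G k i j) \<partial>t m k) \<le> u m k"
    and final: "\<And>\<epsilon>. 0 < \<epsilon> \<Longrightarrow> \<forall>\<^sub>F n in sequentially. \<forall>k. - \<epsilon> \<le> u n k"
  shows "game_value G \<pi> k1 \<le> u 0 k1"
  unfolding game_value_def
proof (rule cSUP_least)
  fix \<sigma> :: "('k, 'i, 'j) strategy1"
  note bounds = weighted_payoff_bounds[OF G \<pi>]
  let ?\<tau> = "\<lambda>(h, k). t (length h) k"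
  have weighted: "\<bar>\<pi> m * stage_payoff G z\<bar> \<le> \<pi> m" for m z
    using G \<pi> by (cases z) (simp add: weights_def game_wf_def stage_payoff_def abs_mult mult_left_le)
  have "- u 0 k1 \<le> (\<integral>\<omega>. (\<Sum>m. - (\<pi> m * stage_payoff G (\<omega> m))) \<partial>play_measure G k1 \<sigma> ?\<tau>)"
  proof (rule payoff_series_ge_potential[where b = \<pi> and u = "\<lambda>m k. - u m k"
        and f = "\<lambda>m z. - (\<pi> m * stage_payoff G z)"])
    fix h :: "('k \<times> 'i \<times> 'j) list" and k
    let ?F = "\<lambda>i j. \<pi> (length h) * payoff G k i j + (\<integral>k'. u (Suc (length h)) k' \<partial>trans G k i j)"
    have "(\<integral>i. (\<integral>j. ?F i j \<partial>t (length h) k) \<partial>\<sigma> (h, k)) \<le> (\<integral>i. u (length h) k \<partial>\<sigma> (h, k))"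
      by (intro integral_pmf_finite_mono step)
    then have "- u (length h) k \<le> - (\<integral>i. (\<integral>j. ?F i j \<partial>t (length h) k) \<partial>\<sigma> (h, k))" by simp
    also have "\<dots> = (\<integral>i. (\<integral>j. - ?F i j \<partial>t (length h) k) \<partial>\<sigma> (h, k))"
      by (simp only: Bochner_Integration.integral_minus)
    finally show "- u (length h) k \<le> (\<integral>i. (\<integral>j. - (\<pi> (length h) * stage_payoff G (k, i, j))
        + (\<integral>k'. - u (Suc (length h)) k' \<partial>trans G k i j) \<partial>(?\<tau> (h, k))) \<partial>\<sigma> (h, k))"
      by (simp add: stage_payoff_def)
  next
    fix \<epsilon> :: real assume "0 < \<epsilon>"
    from final[OF this] show "\<forall>\<^sub>F n in sequentially. \<forall>k. - u n k \<le> \<epsilon>"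
      by eventually_elim (metis minus_le_iff)
  qed (use weighted \<pi> in \<open>auto simp: weights_def sums_iff\<close>)
  moreover have "(\<Sum>m. - (\<pi> m * stage_payoff G (\<omega> m))) = - (\<Sum>m. \<pi> m * stage_payoff G (\<omega> m))" for \<omega>
  proof (rule suminf_minus)
    show "summable (\<lambda>m. \<pi> m * stage_payoff G (\<omega> m))"
    proof (rule summable_comparison_test')
      show "summable \<pi>" using \<pi> by (simp add: weights_def sums_iff)
      show "norm (\<pi> m * stage_payoff G (\<omega> m)) \<le> \<pi> m" for m
        using weighted by (simp only: real_norm_def)
    qed
  qed
  ultimately have "weighted_payoff G \<pi> k1 \<sigma> ?\<tau> \<le> u 0 k1"
    by (simp add: weighted_payoff_def)
  then show "(INF \<tau>. weighted_payoff G \<pi> k1 \<sigma> \<tau>) \<le> u 0 k1"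
    by (intro cINF_lower2[of _ _ ?\<tau>]) (auto intro!: bounds bdd_belowI2)
qed simp

section \<open>Discounted weights: the value is at most 5/8\<close>

definition mixed :: "real \<Rightarrow> 'a \<Rightarrow> 'a \<Rightarrow> 'a pmf" where
  "mixed x a b = map_pmf (\<lambda>c. if c then a else b) (bernoulli_pmf x)"

lemma integral_mixed:
  assumes "0 \<le> x" "x \<le> 1"
  shows "(\<integral>a. F a \<partial>mixed x a1 a2) = x * F a1 + (1 - x) * (F a2 :: real)"
  using assms unfolding mixed_def
  by (simp add: integral_measure_pmf[of UNIV] UNIV_bool)

lemma Gamma_game_simps [simp]:
  "payoff Gamma_game = Gamma_payoff"
  "trans Gamma_game k i j = return_pmf (Gamma_next k i j)"
  by (simp_all add: Gamma_game_def)

definition discounted_weights :: "real \<Rightarrow> nat \<Rightarrow> real" where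
  "discounted_weights r m = r * (1 - r) ^ m"

lemma discounted_weights_in_weights:
  assumes "0 < r" "r < 1"
  shows "discounted_weights r \<in> weights"
proof -
  have "(\<lambda>m. r * (1 - r) ^ m) sums (r * (1 / (1 - (1 - r))))"
    using assms by (intro sums_mult geometric_sums) auto
  then show ?thesis
    using assms by (simp add: weights_def discounted_weights_def[abs_def])
qed

text \<open>
  The limit of the discounted values at both nonabsorbing states is \<open>1 / 2\<close>. The larger constant
  \<open>5 / 8\<close> leaves slack that absorbs all terms of higher order in \<open>s\<close>. The gap \<open>s / 2\<close> is the
  advantage of \<open>Omega1\<close>; it is of the order of the square root of the discount rate.
\<close>

fun discounted_bound :: "real \<Rightarrow> state \<Rightarrow> real" where
  "discounted_bound s Omega1 = 5 / 8"
| "discounted_bound s Omega2 = 5 / 8 - s / 2"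
| "discounted_bound s One_star = 1"
| "discounted_bound s Zero_star = 0"

text \<open>
  If Player 2 plays \<open>Right\<close> with probability \<open>s\<close>, a stage cannot increase the bound, whichever
  action Player 1 chooses. At \<open>Omega1\<close>, \<open>Top\<close> earns the stage weight \<open>s\<^sup>2\<close> but loses the gap with
  probability \<open>s\<close>, and \<open>Bottom\<close> is absorbed with probability \<open>s\<close> but loses the gap otherwise.
  At the nonabsorbing states, the claim is a polynomial inequality in \<open>s\<close> whose lowest-order term
  decides.
\<close>

lemma discounted_bound_step:
  assumes s: "0 < s" "s \<le> 1 / 12"
  shows "s * (s\<^sup>2 * Gamma_payoff k i Right + (1 - s\<^sup>2) * discounted_bound s (Gamma_next k i Right))
    + (1 - s) * (s\<^sup>2 * Gamma_payoff k i Left + (1 - s\<^sup>2) * discounted_bound s (Gamma_next k i Left))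
    \<le> discounted_bound s k"
proof -
  have powers: "0 \<le> s * s" "s * s \<le> s / 12" "0 \<le> s * (s * s)" "s * (s * s) \<le> s * s / 12"
    "0 \<le> s * (s * (s * s))" "s * (s * (s * s)) \<le> s * (s * s) / 12"
    using s mult_right_mono[of s "1 / 12" s] mult_right_mono[of s "1 / 12" "s * s"]
      mult_right_mono[of s "1 / 12" "s * (s * s)"] by auto
  show ?thesis
    by (cases k; cases i; simp add: power2_eq_square field_simps; (insert s powers; linarith)?)
qed

lemma game_value_discounted_le:
  assumes s: "0 < s" "s \<le> 1 / 12"
  shows "game_value Gamma_game (discounted_weights (s\<^sup>2)) Omega1 \<le> 5 / 8"
proof -
  have s2: "0 < s\<^sup>2" "s\<^sup>2 < 1"
    using s by (auto simp: power_less_one_iff)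
  define u where "u m k = (1 - s\<^sup>2) ^ m * discounted_bound s k" for m :: nat and k
  have nonneg: "0 \<le> discounted_bound s k" for k
    using s by (cases k) auto
  have "game_value Gamma_game (discounted_weights (s\<^sup>2)) Omega1 \<le> u 0 Omega1"
  proof (rule game_value_le_potential[where t = "\<lambda>_ _. mixed s Right Left"])
    fix m k i
    let ?g = "\<lambda>j. s\<^sup>2 * Gamma_payoff k i j + (1 - s\<^sup>2) * discounted_bound s (Gamma_next k i j)"
    have "discounted_weights (s\<^sup>2) m * Gamma_payoff k i j + u (Suc m) (Gamma_next k i j)
        = (1 - s\<^sup>2) ^ m * ?g j" for j
      by (simp add: discounted_weights_def u_def algebra_simps)
    then have "(\<integral>j. discounted_weights (s\<^sup>2) m * payoff Gamma_game k i j
        + (\<integral>k'. u (Suc m) k' \<partial>trans Gamma_game k i j) \<partial>mixed s Right Left)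
      = (1 - s\<^sup>2) ^ m * (s * ?g Right + (1 - s) * ?g Left)"
      using s by (simp add: integral_mixed)
    also have "\<dots> \<le> (1 - s\<^sup>2) ^ m * discounted_bound s k"
      using s2 by (intro mult_left_mono discounted_bound_step s) auto
    finally show "(\<integral>j. discounted_weights (s\<^sup>2) m * payoff Gamma_game k i j
        + (\<integral>k'. u (Suc m) k' \<partial>trans Gamma_game k i j) \<partial>mixed s Right Left) \<le> u m k"
      by (simp add: u_def)
  next
    fix \<epsilon> :: real assume "0 < \<epsilon>"
    have "0 \<le> u n k" for n k
      unfolding u_def using nonneg s2 by simp
    then have "- \<epsilon> \<le> u n k" for n k
      using \<open>0 < \<epsilon>\<close> by (meson less_imp_le neg_le_0_iff_le order_trans)
    then show "\<forall>\<^sub>F n in sequentially. \<forall>k. - \<epsilon> \<le> u n k" by simp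
  qed (use s2 in \<open>auto intro!: game_wf_Gamma_game discounted_weights_in_weights\<close>)
  then show ?thesis by (simp add: u_def)
qed

text \<open>For decreasing weights, the series of absolute differences telescopes.\<close>

lemma impatience_decreasing_le:
  assumes p: "0 < p" and dec: "decseq \<pi>" and nonneg: "\<And>m. 0 \<le> \<pi> m"
  shows "impatience p \<pi> \<le> (if p = \<infinity> then ennreal (\<pi> 0) else ennreal (\<pi> 0 powr real_of_ereal p))"
proof (cases "p = \<infinity>")
  case True
  have "(SUP m. ennreal (\<pi> m)) \<le> ennreal (\<pi> 0)"
    by (intro SUP_least ennreal_leI decseqD[OF dec]) simp
  then show ?thesis using True by (simp add: impatience_def)
next
  case False
  with p have p': "0 < real_of_ereal p"
    by (cases p) auto
  define f where "f m = \<pi> m powr real_of_ereal p" for m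
  have f: "f (Suc m) \<le> f m" "0 \<le> f m" for m
    unfolding f_def using p' nonneg decseq_SucD[OF dec] by (auto intro: powr_mono2)
  have "(\<Sum>m. ennreal \<bar>f (Suc m) - f m\<bar>) \<le> ennreal (f 0)"
    unfolding suminf_eq_SUP
  proof (rule SUP_least)
    fix n
    have "(\<Sum>m<n. ennreal \<bar>f (Suc m) - f m\<bar>) = ennreal (\<Sum>m<n. f m - f (Suc m))"
      using f by (subst sum_ennreal) (auto simp: abs_of_nonpos)
    also have "(\<Sum>m<n. f m - f (Suc m)) = f 0 - f n"
      by (rule sum_lessThan_telescope')
    also have "ennreal (f 0 - f n) \<le> ennreal (f 0)"
      using f by (intro ennreal_leI) simp
    finally show "(\<Sum>m<n. ennreal \<bar>f (Suc m) - f m\<bar>) \<le> ennreal (f 0)" .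
  qed
  then show ?thesis
    using False by (simp add: impatience_def f_def)
qed

lemma discounted_weights_arbitrarily_patient:
  assumes p: "0 < p" and \<alpha>: "0 < \<alpha>"
  shows "\<exists>s>0. s \<le> 1 / 12 \<and> impatience p (discounted_weights (s\<^sup>2)) \<le> ennreal \<alpha>"
proof -
  let ?s = "\<lambda>n. 1 / (real n + 12)"
  have dec: "decseq (discounted_weights ((?s n)\<^sup>2))" "0 \<le> discounted_weights ((?s n)\<^sup>2) m" for n m
  proof -
    have "(?s n)\<^sup>2 \<le> 1" by (rule power_le_one) auto
    then show "decseq (discounted_weights ((?s n)\<^sup>2))" "0 \<le> discounted_weights ((?s n)\<^sup>2) m"
      unfolding discounted_weights_def[abs_def]
      by (auto simp: decseq_Suc_iff intro!: mult_left_mono mult_left_le_one_le)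
  qed
  define bound where
    "bound n = (if p = \<infinity> then (?s n)\<^sup>2 else ((?s n)\<^sup>2) powr real_of_ereal p)" for n
  have imp: "impatience p (discounted_weights ((?s n)\<^sup>2)) \<le> ennreal (bound n)" for n
  proof -
    have first: "discounted_weights r 0 = r" for r by (simp add: discounted_weights_def)
    show ?thesis
      using impatience_decreasing_le[OF p dec, of n] unfolding first bound_def
      by (cases "p = \<infinity>") simp_all
  qed
  have "bound \<longlonglongrightarrow> 0"
  proof (cases "p = \<infinity>")
    case True
    have "(\<lambda>n. (?s n)\<^sup>2) \<longlonglongrightarrow> 0" by real_asymp
    then show ?thesis using True by (simp add: bound_def[abs_def])
  next
    case False
    with p have "0 < real_of_ereal p" by (cases p) auto
    then have "(\<lambda>n. ((?s n)\<^sup>2) powr real_of_ereal p) \<longlonglongrightarrow> 0" by real_asymp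
    then show ?thesis using False by (simp add: bound_def[abs_def])
  qed
  then have "\<forall>\<^sub>F n in sequentially. bound n < \<alpha>"
    using \<alpha> by (rule order_tendstoD)
  then obtain n where "bound n < \<alpha>"
    by (auto dest!: eventually_happens'[rotated])
  then have "impatience p (discounted_weights ((?s n)\<^sup>2)) \<le> ennreal \<alpha>"
    using imp[of n] by (meson ennreal_leI less_imp_le order_trans)
  then show ?thesis by (intro exI[of _ "?s n"]) (auto simp: field_simps)
qed

section \<open>Alternating active and idle blocks: the value is at least 3/4\<close>

text \<open>
  There are \<open>cycles l\<close> cycles, each made of an active block of \<open>l\<close> stages with equal weights and of
  an idle block of \<open>rest l\<close> stages with weight \<open>0\<close>. Stage \<open>m\<close> has number \<open>m mod period l\<close> in cycle
  \<open>m div period l\<close>. The ratio \<open>cycles l / l\<close> is what makes active blocks short for Player 1's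
  purposes. The idle blocks do not enter the impatience, so they may be as long as he needs.
\<close>

definition cycles :: "nat \<Rightarrow> nat" where
  "cycles l = 64 * l"

definition rest :: "nat \<Rightarrow> nat" where
  "rest l = 64 * cycles l"

definition period :: "nat \<Rightarrow> nat" where
  "period l = l + rest l"

definition block_weights :: "nat \<Rightarrow> nat \<Rightarrow> real" where
  "block_weights l m =
     (if m div period l < cycles l \<and> m mod period l < l then 1 / (real (cycles l) * real l) else 0)"

text \<open>
  The total weight of the stages from number \<open>r\<close> of cycle \<open>q\<close> on. Number \<open>r = period l\<close> is allowed
  and is the same as number \<open>0\<close> of the next cycle.
\<close>

definition remaining :: "nat \<Rightarrow> nat \<Rightarrow> nat \<Rightarrow> real" where
  "remaining l q r = (real (cycles l) - real q) / real (cycles l)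
     - real (min r l) / (real (cycles l) * real l)"

text \<open>
  What Player 1 secures from number \<open>r\<close> of cycle \<open>q\<close> on. In \<open>Omega1\<close>, this is \<open>7 / 8\<close> of the
  remaining weight, minus \<open>1 / 8\<close>. The subtracted reserve guarantees that absorption in \<open>One_star\<close>
  is worth at least \<open>1 / 8\<close> more to him than continuing, even near the end; this gives his threat
  a fixed strength. In \<open>Omega2\<close>, nothing is earned until the next active block: the bound is
  constant during the active block (truncated subtraction), just below the bound that \<open>Omega1\<close> has
  at the end of that block; during the idle block it decreases linearly to the value that it needs
  one cycle later.
\<close>

fun block_bound :: "nat \<Rightarrow> nat \<Rightarrow> nat \<Rightarrow> state \<Rightarrow> real" where
  "block_bound l q r Omega1 = 7 / 8 * remaining l q r - 1 / 8"
| "block_bound l q r Omega2 = 7 / 8 * remaining l (Suc q) 0 - 1 / 8 - 1 / (8 * real (cycles l))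
     - 7 / (8 * real (cycles l)) * (real (r - l) / real (rest l))"
| "block_bound l q r One_star = remaining l q r"
| "block_bound l q r Zero_star = 0"

text \<open>
  The bound is cut off to \<open>0\<close> after the last cycle, where no weight is left and \<open>remaining\<close> would
  become negative.
\<close>

definition stage_bound :: "nat \<Rightarrow> nat \<Rightarrow> state \<Rightarrow> real" where
  "stage_bound l m k =
     (if m div period l < cycles l then block_bound l (m div period l) (m mod period l) k else 0)"

text \<open>
  In an active block, \<open>Bottom\<close> has probability \<open>8 / cycles l\<close>: by playing \<open>Right\<close> in \<open>Omega1\<close>,
  Player 2 gives away \<open>1 / 8\<close> with that probability, that is \<open>1 / cycles l\<close>, the whole weight of the
  block that she can hope to save. In an idle block, \<open>Bottom\<close> is played in \<open>Omega2\<close> so rarely that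
  the risk of \<open>Zero_star\<close> is an eighth of the weight of one block. The Boolean tells whether
  the block is active.
\<close>

fun block_strategy :: "nat \<Rightarrow> bool \<Rightarrow> state \<Rightarrow> action1 pmf" where
  "block_strategy l True Omega1 = mixed (8 / real (cycles l)) Bottom Top"
| "block_strategy l False Omega2 = mixed (1 / (8 * real (cycles l))) Bottom Top"
| "block_strategy l _ _ = return_pmf Middle"

lemma block_bound_end_of_cycle:
  assumes "0 < l"
  shows "block_bound l q (period l) k = block_bound l (Suc q) 0 k"
  using assms
  by (cases k) (simp_all add: remaining_def period_def rest_def cycles_def field_simps)

lemma block_bound_final_nonpos:
  assumes "0 < l"
  shows "block_bound l (cycles l) 0 k \<le> 0"
  using assms
  by (cases k) (auto simp: remaining_def cycles_def diff_divide_distrib add_divide_distrib intro: order_trans[of _ 0])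

lemma Suc_in_cycle:
  assumes "0 < l"
  obtains "Suc m mod period l = Suc (m mod period l)" "Suc m div period l = m div period l"
      "Suc (m mod period l) < period l"
  | "Suc m mod period l = 0" "Suc m div period l = Suc (m div period l)"
      "Suc (m mod period l) = period l"
proof -
  have "0 < period l" using assms by (simp add: period_def)
  then have "Suc (m mod period l) \<le> period l" by (simp add: Suc_le_eq)
  then show thesis
    using that by (cases "Suc (m mod period l) = period l") (auto simp: mod_Suc div_Suc)
qed

lemma stage_bound_Suc_ge:
  assumes l: "0 < l" and "m div period l < cycles l"
  shows "block_bound l (m div period l) (Suc (m mod period l)) k \<le> stage_bound l (Suc m) k"
  using l
proof (cases rule: Suc_in_cycle[where m = m])
  case 1
  then show ?thesis using assms by (simp add: stage_bound_def)
next
  case 2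
  have "block_bound l (Suc (m div period l)) 0 k \<le> stage_bound l (Suc m) k"
  proof (cases "Suc (m div period l) = cycles l")
    case True
    then show ?thesis
      using 2 block_bound_final_nonpos[OF l, of k] by (simp add: stage_bound_def)
  next
    case False
    then show ?thesis using 2 assms by (simp add: stage_bound_def)
  qed
  then show ?thesis using 2 block_bound_end_of_cycle[OF l, of "m div period l" k] by simp
qed

text \<open>
  The core of the lower bound. In an active block at \<open>Omega1\<close>, against \<open>Left\<close> the risk of moving
  to \<open>Omega2\<close> costs at most an eighth of the stage weight, since
  \<open>8 / cycles l\<close> times \<open>1 / cycles l\<close> is exactly that; against \<open>Right\<close> the threat of absorption
  pays for the lost rest of the block. In an idle block at \<open>Omega2\<close>, against \<open>Right\<close> the risk of
  \<open>Zero_star\<close> is covered by the margin \<open>1 / (8 * cycles l)\<close> between the bounds in the two states;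
  against \<open>Left\<close>, \<open>rest l\<close> is large enough for the slow decrease of the bound to be paid for by the
  chance of moving to \<open>Omega1\<close>. In all other cases the bound drops by exactly what is earned.
\<close>

lemma block_bound_step:
  assumes l: "0 < l" and q: "q < cycles l" and r: "r < period l"
  shows "block_bound l q r k \<le> (\<integral>i. (if r < l then 1 / (real (cycles l) * real l) else 0)
      * Gamma_payoff k i j + block_bound l q (Suc r) (Gamma_next k i j) \<partial>block_strategy l (r < l) k)"
proof -
  \<comment> \<open>In terms of the weight \<open>e\<close> of a block and the weight \<open>w\<close> of an active stage, all cases become
    polynomial inequalities, linear in the few products collected in \<open>products\<close>.\<close>
  define e where "e = 1 / real (cycles l)"
  define w where "w = e / real l"
  have e: "0 < e" "64 * e \<le> 1" and w: "w = 64 * (e * e)" "0 < w"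
    using l by (auto simp: e_def w_def cycles_def field_simps)
  have weight: "1 / (real (cycles l) * real l) = w" by (simp add: e_def w_def)
  have lw: "real l * w = e" using l by (simp add: w_def)
  have x: "8 / real (cycles l) = 8 * e" "1 / (8 * real (cycles l)) = e / 8" 
      "7 / (8 * real (cycles l)) = 7 / 8 * e"
    by (auto simp: e_def)
  have mixed_x: "(\<integral>i. F i \<partial>mixed (8 * e) Bottom Top) = 8 * e * F Bottom + (1 - 8 * e) * F Top"
    and mixed_y: "(\<integral>i. F i \<partial>mixed (e / 8) Bottom Top) = e / 8 * F Bottom + (1 - e / 8) * F Top"
    for F :: "action1 \<Rightarrow> real"
    using e by (simp_all add: integral_mixed)
  define R where "R = remaining l (Suc q) 0"
  have "real (Suc q) \<le> real (cycles l)" using q by (simp only: of_nat_le_iff)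
  then have R: "0 \<le> R" "R \<le> 1"
    by (auto simp: R_def remaining_def field_simps)
  have rem: "remaining l q r = R + e - real (min r l) * w" for r
    using l by (simp add: R_def remaining_def e_def w_def diff_divide_distrib add_divide_distrib)
  show ?thesis
  proof (cases "r < l")
    case True
    \<comment> \<open>The weight of the block spent after this stage.\<close>
    define t where "t = real (Suc r) * w"
    have "real (Suc r) * w \<le> real l * w" using True w by (intro mult_right_mono) auto
    then have t: "t \<le> e" by (simp add: t_def lw)
    have "1 * w \<le> real (Suc r) * w" using w(2) by (intro mult_right_mono) auto
    then have "0 \<le> t" using w(2) by (simp add: t_def)
    have now: "remaining l q r = R + e - t + w" and later: "remaining l q (Suc r) = R + e - t"
      using True by (auto simp: rem t_def min_def algebra_simps)
    have products: "0 \<le> e * t" "0 \<le> R * e" "e * t \<le> e * e"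
      using e \<open>0 \<le> t\<close> t R by (simp_all add: mult_left_mono)
    have "Suc r \<le> l" using True by simp
    then have diff: "Suc r - l = 0" "r - l = 0" by simp_all
    show ?thesis
      by (cases k; cases j; simp add: True diff weight mixed_x x now later R_def[symmetric]
          del: of_nat_Suc; simp add: field_simps; (insert products e R t w \<open>0 \<le> t\<close>; linarith)?)
  next
    case False
    \<comment> \<open>\<open>t\<close> and \<open>t'\<close> are the elapsed fractions of the idle block before and after this stage, and
      the bound at \<open>Omega2\<close> drops by \<open>7 / 8 * d\<close> in between.\<close>
    define d where "d = e / real (rest l)"
    have d: "0 < d" "64 * d = e * e" using l by (auto simp: d_def e_def rest_def cycles_def field_simps)
    define t t' where "t = real (r - l) / real (rest l)" and "t' = real (Suc r - l) / real (rest l)"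
    have t: "0 \<le> t" "0 \<le> t'" "e * t' = e * t + d"
      using False by (auto simp: t_def t'_def d_def Suc_diff_le add_divide_distrib distrib_left)
    have now: "remaining l q r = R" "remaining l q (Suc r) = R"
      using False lw by (auto simp: rem min_def)
    have products: "0 \<le> e * (e * t')" "0 \<le> e * t" "R * e \<le> e"
      using e t(1,2) R by simp_all
    show ?thesis
      by (cases k; cases j; simp add: False mixed_y x now R_def[symmetric] t_def[symmetric] t'_def[symmetric]
          del: of_nat_Suc; simp add: field_simps; (insert products e R t d; linarith)?)
  qed
qed

text \<open>
  At \<open>One_star\<close> the bound is the remaining weight, so this identity also yields the total weight by
  telescoping.
\<close>

lemma block_weights_eq_difference:
  assumes l: "0 < l"
  shows "block_weights l m = stage_bound l m One_star - stage_bound l (Suc m) One_star"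
proof (cases "m div period l < cycles l")
  case False
  moreover have "m div period l \<le> Suc m div period l" by (rule div_le_mono) simp
  ultimately have "\<not> Suc m div period l < cycles l" by linarith
  then show ?thesis using False by (simp add: block_weights_def stage_bound_def)
next
  case True
  let ?q = "m div period l" and ?r = "m mod period l"
  have "stage_bound l (Suc m) One_star = remaining l ?q (Suc ?r)"
    using l
  proof (cases rule: Suc_in_cycle[where m = m])
    case 1
    then show ?thesis using True by (simp add: stage_bound_def)
  next
    case 2
    have "remaining l ?q (Suc ?r) = remaining l (Suc ?q) 0"
      using block_bound_end_of_cycle[OF l, of ?q One_star] 2 by simp
    moreover have "remaining l (Suc ?q) 0 = 0" if "\<not> Suc ?q < cycles l"
      using that True by (simp add: remaining_def not_less_less_Suc_eq flip: of_nat_Suc)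
    ultimately show ?thesis using 2 by (auto simp: stage_bound_def)
  qed
  then show ?thesis
    using True by (simp add: stage_bound_def block_weights_def remaining_def min_def add_divide_distrib)
qed

lemma stage_bound_eventually_zero:
  assumes "0 < l"
  shows "\<forall>\<^sub>F m in sequentially. \<forall>k. stage_bound l m k = 0"
  unfolding eventually_sequentially
proof (intro exI allI impI)
  fix m k assume "cycles l * period l \<le> m"
  then have "cycles l \<le> m div period l"
    using assms by (simp add: period_def less_eq_div_iff_mult_less_eq)
  then show "stage_bound l m k = 0" by (simp add: stage_bound_def)
qed

lemma block_weights_in_weights:
  assumes l: "0 < l"
  shows "block_weights l \<in> weights"
proof -
  have "(\<lambda>m. stage_bound l m One_star) \<longlonglongrightarrow> 0"
    by (rule tendsto_eventually) (use stage_bound_eventually_zero[OF l] in \<open>auto elim: eventually_mono\<close>)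
  from telescope_sums'[OF this] have "block_weights l sums stage_bound l 0 One_star"
    by (simp flip: block_weights_eq_difference[OF l])
  also have "stage_bound l 0 One_star = 1"
    using l by (simp add: stage_bound_def remaining_def cycles_def)
  finally have "block_weights l sums 1" .
  moreover have "0 \<le> block_weights l m" for m by (simp add: block_weights_def)
  ultimately show ?thesis by (simp add: weights_def)
qed

lemma game_value_block_ge:
  assumes l: "0 < l"
  shows "3 / 4 \<le> game_value Gamma_game (block_weights l) Omega1"
proof -
  have "stage_bound l 0 Omega1 \<le> game_value Gamma_game (block_weights l) Omega1"
  proof (rule game_value_ge_potential[where s = "\<lambda>m. block_strategy l (m mod period l < l)"])
    fix m k j
    let ?q = "m div period l" and ?r = "m mod period l"
    let ?s = "block_strategy l (?r < l) k"
    show "stage_bound l m k \<le> (\<integral>i. block_weights l m * payoff Gamma_game k i j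
        + (\<integral>k'. stage_bound l (Suc m) k' \<partial>trans Gamma_game k i j) \<partial>?s)"
    proof (cases "?q < cycles l")
      case True
      have "stage_bound l m k \<le> (\<integral>i. (if ?r < l then 1 / (real (cycles l) * real l) else 0)
          * Gamma_payoff k i j + block_bound l ?q (Suc ?r) (Gamma_next k i j) \<partial>?s)"
        using block_bound_step[OF l True, of ?r k j] True l by (simp add: stage_bound_def period_def)
      also have "\<dots> \<le> (\<integral>i. block_weights l m * Gamma_payoff k i j
          + stage_bound l (Suc m) (Gamma_next k i j) \<partial>?s)"
        using True by (intro integral_pmf_finite_mono add_mono stage_bound_Suc_ge l)
          (simp_all add: block_weights_def)
      finally show ?thesis by simp
    next
      case False
      moreover have "?q \<le> Suc m div period l" by (rule div_le_mono) simp
      ultimately have "\<not> Suc m div period l < cycles l" by linarith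
      then show ?thesis using False by (simp add: stage_bound_def block_weights_def)
    qed
  next
    fix \<epsilon> :: real assume "0 < \<epsilon>"
    then show "\<forall>\<^sub>F n in sequentially. \<forall>k. stage_bound l n k \<le> \<epsilon>"
      using stage_bound_eventually_zero[OF l] by (auto elim: eventually_mono)
  qed (use l in \<open>auto intro!: game_wf_Gamma_game block_weights_in_weights\<close>)
  moreover have "stage_bound l 0 Omega1 = 3 / 4"
    using l by (simp add: stage_bound_def remaining_def cycles_def)
  ultimately show ?thesis by simp
qed

section \<open>Patience of the alternating weights\<close>

lemma impatience_block_weights_infinity:
  "impatience \<infinity> (block_weights l) \<le> ennreal (1 / (real (cycles l) * real l))"
  by (auto simp: impatience_def block_weights_def intro!: SUP_least ennreal_leI)

text \<open>Consecutive weights differ only at the two ends of each cycle's active block.\<close>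

lemma impatience_block_weights_finite:
  assumes l: "0 < l" and p: "0 < p"
  shows "impatience (ereal p) (block_weights l)
    \<le> ennreal (2 * real (cycles l) * (1 / (real (cycles l) * real l)) powr p)"
proof -
  \<comment> \<open>The last stages of active blocks and the last stages of idle blocks.\<close>
  define S where "S = (\<lambda>q. q * period l + (l - 1)) ` {..<cycles l}
    \<union> (\<lambda>q. q * period l + (period l - 1)) ` {..<cycles l}"
  define c where "c = (1 / (real (cycles l) * real l)) powr p"
  let ?d = "\<lambda>m. \<bar>block_weights l (Suc m) powr p - block_weights l m powr p\<bar>"
  have fin: "finite S" by (simp add: S_def)
  have "card S \<le> cycles l + cycles l"
    unfolding S_def
    by (rule order_trans[OF card_Un_le]) (intro add_mono order_trans[OF card_image_le], simp_all)
  then have card: "real (card S) \<le> 2 * real (cycles l)"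
    by (simp flip: of_nat_add)
  have zero: "?d m = 0" if "m \<notin> S" for m
  proof -
    let ?q = "m div period l" and ?r = "m mod period l"
    have m: "m = ?q * period l + ?r" by simp
    have "m \<in> S" if "?q < cycles l" "?r = l - 1 \<or> ?r = period l - 1"
      unfolding S_def image_Un[symmetric]
      using that m by (metis (no_types, lifting) UnCI imageI lessThan_iff)
    then have no_switch: "?r \<noteq> l - 1" "?r \<noteq> period l - 1" if "?q < cycles l"
      using that \<open>m \<notin> S\<close> by blast+
    have "block_weights l (Suc m) = block_weights l m"
      using l
    proof (cases rule: Suc_in_cycle[where m = m])
      case 1
      have "Suc ?r < l \<longleftrightarrow> ?r < l" if "?q < cycles l"
        using no_switch[OF that] l by linarith
      then show ?thesis using 1 by (auto simp: block_weights_def)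
    next
      case 2
      then have "\<not> ?q < cycles l" using no_switch by force
      then show ?thesis using 2 by (simp add: block_weights_def)
    qed
    then show ?thesis by simp
  qed
  have le: "?d m \<le> c" for m
    using p by (auto simp: block_weights_def c_def)
  have "impatience (ereal p) (block_weights l) = (\<Sum>m\<in>S. ennreal (?d m))"
    unfolding impatience_def using zero by (simp add: suminf_finite[OF fin])
  also have "\<dots> = ennreal (\<Sum>m\<in>S. ?d m)"
    by (rule sum_ennreal) simp
  also have "(\<Sum>m\<in>S. ?d m) \<le> real (card S) * c"
    by (rule sum_bounded_above) (rule le)
  also have "\<dots> \<le> 2 * real (cycles l) * c"
    using card by (intro mult_right_mono) (auto simp: c_def)
  finally show ?thesis unfolding c_def by (simp add: ennreal_leI)
qed

text \<open>
  For finite \<open>p\<close>, the bound on the impatience is a constant times \<open>l powr (1 - 2 * p)\<close>.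
\<close>

lemma block_weights_arbitrarily_patient:
  assumes p: "1 / 2 < p" and \<alpha>: "0 < \<alpha>"
  shows "\<exists>l>0. impatience p (block_weights l) \<le> ennreal \<alpha>"
proof (cases "p = \<infinity>")
  case True
  have "(\<lambda>l. 1 / (real (cycles l) * real l)) \<longlonglongrightarrow> 0"
    unfolding cycles_def of_nat_mult by real_asymp
  then have "\<forall>\<^sub>F l in sequentially. 1 / (real (cycles l) * real l) < \<alpha>"
    using \<alpha> by (rule order_tendstoD)
  then have "\<forall>\<^sub>F l in sequentially. 0 < l \<and> 1 / (real (cycles l) * real l) < \<alpha>"
    using eventually_gt_at_top by (rule eventually_conj[rotated])
  then obtain l where "0 < l" "1 / (real (cycles l) * real l) < \<alpha>"
    by (auto dest!: eventually_happens'[rotated])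
  then show ?thesis
    using True impatience_block_weights_infinity[of l]
    by (meson ennreal_leI less_imp_le order_trans)
next
  case False
  then obtain x where x: "p = ereal x" "1 / 2 < x"
    using p by (cases p) (auto simp: one_ereal_def numeral_eq_ereal)
  then have "0 < 2 * x - 1" by simp
  then have "(\<lambda>l. 2 * real (cycles l) * (1 / (real (cycles l) * real l)) powr x) \<longlonglongrightarrow> 0"
    unfolding cycles_def of_nat_mult by real_asymp
  then have "\<forall>\<^sub>F l in sequentially. 2 * real (cycles l) * (1 / (real (cycles l) * real l)) powr x < \<alpha>"
    using \<alpha> by (rule order_tendstoD)
  then have "\<forall>\<^sub>F l in sequentially. 0 < l \<and> 2 * real (cycles l) * (1 / (real (cycles l) * real l)) powr x < \<alpha>"
    using eventually_gt_at_top by (rule eventually_conj[rotated])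
  then obtain l where "0 < l" "2 * real (cycles l) * (1 / (real (cycles l) * real l)) powr x < \<alpha>"
    by (auto dest!: eventually_happens'[rotated])
  moreover from this have "impatience p (block_weights l)
      \<le> ennreal (2 * real (cycles l) * (1 / (real (cycles l) * real l)) powr x)"
    using x by (simp add: impatience_block_weights_finite)
  ultimately show ?thesis
    by (meson ennreal_leI less_imp_le order_trans)
qed

section \<open>Absence of an asymptotic value\<close>

text \<open>
  A \<open>p\<close>-asymptotic value would place both values within \<open>1 / 32\<close> of the same number, whereas they
  are at least \<open>1 / 8\<close> apart.
\<close>

theorem theorem4:
  fixes p :: ereal
  assumes "p > 1 / 2"
  shows "\<not> has_p_asymptotic_value p Gamma_game"
proof
  assume "has_p_asymptotic_value p Gamma_game"
  then obtain \<alpha> where "0 < \<alpha>" and \<alpha>: "\<And>\<pi>. \<pi> \<in> weights \<Longrightarrow> impatience p \<pi> \<le> ennreal \<alpha> \<Longrightarrow>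
      (MAX k. \<bar>game_value Gamma_game \<pi> k - uniform_value Gamma_game k\<bar>) \<le> 1 / 32"
    unfolding has_p_asymptotic_value_def by (metis zero_less_divide_1_iff zero_less_numeral)
  have close: "\<bar>game_value Gamma_game \<pi> Omega1 - uniform_value Gamma_game Omega1\<bar> \<le> 1 / 32"
    if "\<pi> \<in> weights" "impatience p \<pi> \<le> ennreal \<alpha>" for \<pi>
    by (rule order_trans[OF Max_ge \<alpha>[OF that]]) auto
  have "0 < p"
    using assms by (cases p) (auto simp: one_ereal_def numeral_eq_ereal)
  then obtain s where s: "0 < s" "s \<le> 1 / 12"
      "impatience p (discounted_weights (s\<^sup>2)) \<le> ennreal \<alpha>"
    using discounted_weights_arbitrarily_patient \<open>0 < \<alpha>\<close> by blast
  obtain l where l: "0 < l" "impatience p (block_weights l) \<le> ennreal \<alpha>"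
    using block_weights_arbitrarily_patient[OF assms \<open>0 < \<alpha>\<close>] by blast
  have "discounted_weights (s\<^sup>2) \<in> weights"
    using s by (intro discounted_weights_in_weights) (auto simp: power_less_one_iff)
  from close[OF this s(3)] close[OF block_weights_in_weights[OF l(1)] l(2)]
  show False
    using game_value_discounted_le[OF s(1,2)] game_value_block_ge[OF l(1)] by linarith
qed

end
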